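(* $\mathrm{AIRAIndL}(\mathrel{\perp\!\!\!\perp})$ is sound: for every set $\Sigma$ of independence atoms, if $\Sigma \vdash \vec{x} \perp \vec{y}$ then $\Sigma \models \vec{x} \perp \vec{y}$.
   Context: Let $(\mathbf{K}, \preccurlyeq)$ be an AEC with amalgamation, joint embedding and arbitrarily large models, with monster model $\mathfrak{M}$, and $\mathrel{\perp\!\!\!\perp}$ any pre-independence relation on bounded subsets of $\mathfrak{M}$ (satisfying Invariance, Existence, Monotonicity, Base Monotonicity, Symmetry, Transitivity, Normality, Finite Character, Anti-Reflexivity). Formulas are atoms $\vec{x} \perp \vec{y}$ with $\vec{x},\vec{y}$ finite sequences of variables. Semantics: for an assignment $s$ into $\mathfrak{M}$ whose domain contains the variables, $\mathfrak{M} \models_s \vec{x} \perp \vec{y}$ iff $s(\vec{x}) \mathrel{\perp\!\!\!\perp}_{\emptyset} s(\vec{y})$; $\Sigma \models \vec{x} \perp \vec{y}$ iff every such $s$ satisfying all atoms of $\Sigma$ satisfies $\vec{x} \perp \vec{y}$. Deductive system: ($a_3$) $\vec{x} \perp \emptyset$; ($b_3$) from $\vec{x} \perp \vec{y}$ infer $\vec{y} \perp \vec{x}$; ($c_3$) from $\vec{x} \perp \vec{y}\vec{z}$ infer $\vec{x} \perp \vec{y}$; ($d_3$) from $\vec{x} \perp \vec{y}$ and $\vec{x}\vec{y} \perp \vec{z}$ infer $\vec{x} \perp \vec{y}\vec{z}$; ($e_3$) from $x \perp x$ infer $x \perp \vec{y}$ for arbitrary $\vec{y}$; ($f_3$) from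 $\vec{x} \perp \vec{y}$ infer $\pi\vec{x} \perp \sigma\vec{y}$ for permutations $\pi,\sigma$; ($g_3$) from $\vec{x} y \vec{z} \perp \vec{w}$ infer $\vec{x} y y \vec{z} \perp \vec{w}$. $\Sigma \vdash \phi$ means there is a deduction of $\phi$ from $\Sigma$ using these rules. *)

theory Defs
  imports Complex_Main "HOL-Library.Multiset"
begin

unbundle cardinal_syntax

record ('f, 'r) vocabulary =
  fsyms :: "'f set"
  rsyms :: "'r set"
  far :: "'f \<Rightarrow> nat"
  rar :: "'r \<Rightarrow> nat"

record ('f, 'r, 'a) struct =
  univ :: "'a set"
  fint :: "'f \<Rightarrow> 'a list \<Rightarrow> 'a"
  rint :: "'r \<Rightarrow> 'a list set"

definition tuples :: "nat \<Rightarrow> 'a set \<Rightarrow> 'a list set" where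
  "tuples n A = {xs. length xs = n \<and> set xs \<subseteq> A}"

text \<open>Interpretations are fixed outside the vocabulary and outside the universe, so that
  equality of records is equality of structures.\<close>

definition is_struct :: "('f, 'r) vocabulary \<Rightarrow> ('f, 'r, 'a) struct \<Rightarrow> bool" where
  "is_struct L M \<longleftrightarrow>
     univ M \<noteq> {} \<and>
     (\<forall>g\<in>fsyms L. \<forall>xs\<in>tuples (far L g) (univ M). fint M g xs \<in> univ M) \<and>
     (\<forall>g xs. \<not> (g \<in> fsyms L \<and> xs \<in> tuples (far L g) (univ M)) \<longrightarrow> fint M g xs = undefined) \<and>
     (\<forall>R\<in>rsyms L. rint M R \<subseteq> tuples (rar L R) (univ M)) \<and>
     (\<forall>R. R \<notin> rsyms L \<longrightarrow> rint M R = {})"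

definition substruct ::
  "('f, 'r) vocabulary \<Rightarrow> ('f, 'r, 'a) struct \<Rightarrow> ('f, 'r, 'a) struct \<Rightarrow> bool" where
  "substruct L M N \<longleftrightarrow>
     is_struct L M \<and> is_struct L N \<and> univ M \<subseteq> univ N \<and>
     (\<forall>g\<in>fsyms L. \<forall>xs\<in>tuples (far L g) (univ M). fint M g xs = fint N g xs) \<and>
     (\<forall>R\<in>rsyms L. rint M R = rint N R \<inter> tuples (rar L R) (univ M))"

definition struct_iso ::
  "('f, 'r) vocabulary \<Rightarrow> ('a \<Rightarrow> 'a) \<Rightarrow> ('f, 'r, 'a) struct \<Rightarrow> ('f, 'r, 'a) struct \<Rightarrow> bool" where
  "struct_iso L h M N \<longleftrightarrow>
     is_struct L M \<and> is_struct L N \<and> bij_betw h (univ M) (univ N) \<and>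
     (\<forall>g\<in>fsyms L. \<forall>xs\<in>tuples (far L g) (univ M). h (fint M g xs) = fint N g (map h xs)) \<and>
     (\<forall>R\<in>rsyms L. \<forall>xs\<in>tuples (rar L R) (univ M). xs \<in> rint M R \<longleftrightarrow> map h xs \<in> rint N R)"

text \<open>The union is used for chains of substructures only; there the choice of \<open>M\<close> is immaterial.\<close>

definition union_struct ::
  "('f, 'r) vocabulary \<Rightarrow> ('f, 'r, 'a) struct set \<Rightarrow> ('f, 'r, 'a) struct" where
  "union_struct L S =
     \<lparr> univ = (\<Union>M\<in>S. univ M),
       fint = (\<lambda>g xs. if g \<in> fsyms L \<and> (\<exists>M\<in>S. xs \<in> tuples (far L g) (univ M))
                 then fint (SOME M. M \<in> S \<and> xs \<in> tuples (far L g) (univ M)) g xs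
                 else undefined),
       rint = (\<lambda>R. \<Union>M\<in>S. rint M R) \<rparr>"

text \<open>Increasing continuous chains are indexed by the field of a nonempty well-order \<open>r\<close>,
  standing for an ordinal. Index sets inside \<open>'a\<close> are enough: a strictly increasing
  well-ordered chain of subsets of \<open>'a\<close> has at most \<open>|UNIV :: 'a set|\<close> members.\<close>

definition is_limit :: "'i rel \<Rightarrow> 'i \<Rightarrow> bool" where
  "is_limit r j \<longleftrightarrow>
     underS r j \<noteq> {} \<and> (\<forall>i\<in>underS r j. \<exists>k\<in>underS r j. i \<in> underS r k)"

definition continuous_chain ::
  "('f, 'r) vocabulary \<Rightarrow> ('f, 'r, 'a) struct set
   \<Rightarrow> (('f, 'r, 'a) struct \<Rightarrow> ('f, 'r, 'a) struct \<Rightarrow> bool)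
   \<Rightarrow> 'i rel \<Rightarrow> ('i \<Rightarrow> ('f, 'r, 'a) struct) \<Rightarrow> bool" where
  "continuous_chain L K le r C \<longleftrightarrow>
     Well_order r \<and> Field r \<noteq> {} \<and>
     (\<forall>i\<in>Field r. C i \<in> K) \<and>
     (\<forall>i j. (i, j) \<in> r \<longrightarrow> le (C i) (C j)) \<and>
     (\<forall>j\<in>Field r. is_limit r j \<longrightarrow> C j = union_struct L (C ` underS r j))"

definition LS_bound ::
  "('f, 'r) vocabulary \<Rightarrow> ('f, 'r, 'a) struct set
   \<Rightarrow> (('f, 'r, 'a) struct \<Rightarrow> ('f, 'r, 'a) struct \<Rightarrow> bool) \<Rightarrow> 'a rel \<Rightarrow> bool" where
  "LS_bound L K le \<mu> \<longleftrightarrow>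
     Card_order \<mu> \<and> natLeq \<le>o \<mu> \<and> |fsyms L| \<le>o \<mu> \<and> |rsyms L| \<le>o \<mu> \<and>
     (\<forall>M\<in>K. \<forall>A\<subseteq>univ M. \<exists>N. le N M \<and> A \<subseteq> univ N \<and> |univ N| \<le>o |A| +c \<mu>)"

text \<open>A class of structures is represented by its members with universe contained in the type
  \<open>'a\<close>. Since \<open>'a\<close> is arbitrary, this is the restriction of a proper class to the
  cardinalities up to an arbitrary bound.\<close>

locale aec =
  fixes L :: "('f, 'r) vocabulary"
    and K :: "('f, 'r, 'a) struct set"
    and le :: "('f, 'r, 'a) struct \<Rightarrow> ('f, 'r, 'a) struct \<Rightarrow> bool"
  assumes K_struct: "M \<in> K \<Longrightarrow> is_struct L M"
    and le_in_K: "le M N \<Longrightarrow> M \<in> K \<and> N \<in> K"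
    and le_refl: "M \<in> K \<Longrightarrow> le M M"
    and le_antisym: "le M N \<Longrightarrow> le N M \<Longrightarrow> M = N"
    and le_trans: "le M N \<Longrightarrow> le N P \<Longrightarrow> le M P"
    and K_iso: "M \<in> K \<Longrightarrow> struct_iso L h M N \<Longrightarrow> N \<in> K"
    and le_iso: "le M N \<Longrightarrow> struct_iso L h N N' \<Longrightarrow> struct_iso L h M M' \<Longrightarrow> le M' N'"
    and le_substruct: "le M N \<Longrightarrow> substruct L M N"
    and coherence: "le M P \<Longrightarrow> le N P \<Longrightarrow> substruct L M N \<Longrightarrow> le M N"
    and chain_in_K: "continuous_chain L K le (r :: 'a rel) C \<Longrightarrow>
          union_struct L (C ` Field r) \<in> K"
    and chain_upper: "continuous_chain L K le (r :: 'a rel) C \<Longrightarrow> j \<in> Field r \<Longrightarrow>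
          le (C j) (union_struct L (C ` Field r))"
    and chain_least: "continuous_chain L K le (r :: 'a rel) C \<Longrightarrow>
          (\<forall>i\<in>Field r. le (C i) M) \<Longrightarrow> le (union_struct L (C ` Field r)) M"
    and Loewenheim_Skolem: "\<exists>\<mu>. LS_bound L K le \<mu>"

definition K_embedding ::
  "('f, 'r) vocabulary \<Rightarrow> (('f, 'r, 'a) struct \<Rightarrow> ('f, 'r, 'a) struct \<Rightarrow> bool)
   \<Rightarrow> ('a \<Rightarrow> 'a) \<Rightarrow> ('f, 'r, 'a) struct \<Rightarrow> ('f, 'r, 'a) struct \<Rightarrow> bool" where
  "K_embedding L le h M N \<longleftrightarrow> (\<exists>M'. struct_iso L h M M' \<and> le M' N)"

definition amalgamation ::
  "('f, 'r) vocabulary \<Rightarrow> ('f, 'r, 'a) struct set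
   \<Rightarrow> (('f, 'r, 'a) struct \<Rightarrow> ('f, 'r, 'a) struct \<Rightarrow> bool) \<Rightarrow> bool" where
  "amalgamation L K le \<longleftrightarrow>
     (\<forall>M0 M1 M2. le M0 M1 \<and> le M0 M2 \<longrightarrow>
        (\<exists>N\<in>K. \<exists>h1 h2. K_embedding L le h1 M1 N \<and> K_embedding L le h2 M2 N \<and>
           (\<forall>a\<in>univ M0. h1 a = h2 a)))"

definition joint_embedding ::
  "('f, 'r) vocabulary \<Rightarrow> ('f, 'r, 'a) struct set
   \<Rightarrow> (('f, 'r, 'a) struct \<Rightarrow> ('f, 'r, 'a) struct \<Rightarrow> bool) \<Rightarrow> bool" where
  "joint_embedding L K le \<longleftrightarrow>
     (\<forall>M1\<in>K. \<forall>M2\<in>K. \<exists>N\<in>K. \<exists>h1 h2. K_embedding L le h1 M1 N \<and> K_embedding L le h2 M2 N)"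

text \<open>Arbitrarily large relative to the cardinalities available in \<open>'a\<close>.\<close>

definition arbitrarily_large_models :: "('f, 'r, 'a) struct set \<Rightarrow> bool" where
  "arbitrarily_large_models K \<longleftrightarrow> (\<forall>X :: 'a set. \<exists>M\<in>K. |X| \<le>o |univ M| )"

text \<open>The monster model is universal and strongly model homogeneous for a cardinal \<open>\<kappa>\<close> above
  the Loewenheim-Skolem number; a subset is bounded if its cardinality is below \<open>\<kappa>\<close>.\<close>

definition monster ::
  "('f, 'r) vocabulary \<Rightarrow> ('f, 'r, 'a) struct set
   \<Rightarrow> (('f, 'r, 'a) struct \<Rightarrow> ('f, 'r, 'a) struct \<Rightarrow> bool)
   \<Rightarrow> 'a rel \<Rightarrow> ('f, 'r, 'a) struct \<Rightarrow> bool" where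
  "monster L K le \<kappa> \<MM> \<longleftrightarrow>
     \<MM> \<in> K \<and> Card_order \<kappa> \<and> (\<exists>\<mu>. LS_bound L K le \<mu> \<and> \<mu> <o \<kappa>) \<and>
     (\<forall>N\<in>K. |univ N| <o \<kappa> \<longrightarrow> (\<exists>h. K_embedding L le h N \<MM>)) \<and>
     (\<forall>M N. le M \<MM> \<and> le M N \<and> |univ N| <o \<kappa> \<longrightarrow>
        (\<exists>h. K_embedding L le h N \<MM> \<and> (\<forall>a\<in>univ M. h a = a))) \<and>
     (\<forall>M N h. le M \<MM> \<and> le N \<MM> \<and> |univ M| <o \<kappa> \<and> struct_iso L h M N \<longrightarrow>
        (\<exists>h'. struct_iso L h' \<MM> \<MM> \<and> (\<forall>a\<in>univ M. h' a = h a)))"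

definition bounded_subset :: "'a rel \<Rightarrow> ('f, 'r, 'a) struct \<Rightarrow> 'a set \<Rightarrow> bool" where
  "bounded_subset \<kappa> \<MM> A \<longleftrightarrow> A \<subseteq> univ \<MM> \<and> |A| <o \<kappa>"

text \<open>\<open>ind A C B\<close> reads: \<open>A\<close> is independent from \<open>B\<close> over the base \<open>C\<close>.\<close>

locale pre_independence =
  fixes L :: "('f, 'r) vocabulary"
    and \<kappa> :: "'a rel"
    and \<MM> :: "('f, 'r, 'a) struct"
    and ind :: "'a set \<Rightarrow> 'a set \<Rightarrow> 'a set \<Rightarrow> bool"
  assumes invariance:
      "\<lbrakk>bounded_subset \<kappa> \<MM> A; bounded_subset \<kappa> \<MM> B; bounded_subset \<kappa> \<MM> C;
        ind A C B; struct_iso L h \<MM> \<MM>\<rbrakk> \<Longrightarrow> ind (h ` A) (h ` C) (h ` B)"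
    and existence:
      "\<lbrakk>bounded_subset \<kappa> \<MM> A; bounded_subset \<kappa> \<MM> C\<rbrakk> \<Longrightarrow> ind A C C"
    and monotonicity:
      "\<lbrakk>bounded_subset \<kappa> \<MM> A; bounded_subset \<kappa> \<MM> B; bounded_subset \<kappa> \<MM> C;
        ind A C B; A' \<subseteq> A; B' \<subseteq> B\<rbrakk> \<Longrightarrow> ind A' C B'"
    and base_monotonicity:
      "\<lbrakk>bounded_subset \<kappa> \<MM> A; bounded_subset \<kappa> \<MM> B; D \<subseteq> C; C \<subseteq> B; ind A D B\<rbrakk>
        \<Longrightarrow> ind A C B"
    and symmetry:
      "\<lbrakk>bounded_subset \<kappa> \<MM> A; bounded_subset \<kappa> \<MM> B; bounded_subset \<kappa> \<MM> C;
        ind A C B\<rbrakk> \<Longrightarrow> ind B C A"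
    and transitivity:
      "\<lbrakk>bounded_subset \<kappa> \<MM> A; bounded_subset \<kappa> \<MM> B; D \<subseteq> C; C \<subseteq> B; ind B C A; ind C D A\<rbrakk>
        \<Longrightarrow> ind B D A"
    and normality:
      "\<lbrakk>bounded_subset \<kappa> \<MM> A; bounded_subset \<kappa> \<MM> B; bounded_subset \<kappa> \<MM> C;
        ind A C B\<rbrakk> \<Longrightarrow> ind (A \<union> C) C B"
    and finite_character:
      "\<lbrakk>bounded_subset \<kappa> \<MM> A; bounded_subset \<kappa> \<MM> B; bounded_subset \<kappa> \<MM> C;
        \<forall>A0. finite A0 \<and> A0 \<subseteq> A \<longrightarrow> ind A0 C B\<rbrakk> \<Longrightarrow> ind A C B"
    and anti_reflexivity:
      "\<lbrakk>bounded_subset \<kappa> \<MM> A; bounded_subset \<kappa> \<MM> B; bounded_subset \<kappa> \<MM> C;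
        ind A C A\<rbrakk> \<Longrightarrow> ind A C B"

datatype 'v atom = Indep "'v list" "'v list"  (infix "\<bottom>" 55)

fun vars :: "'v atom \<Rightarrow> 'v set" where
  "vars (xs \<bottom> ys) = set xs \<union> set ys"

definition assignment :: "('f, 'r, 'a) struct \<Rightarrow> ('v \<rightharpoonup> 'a) \<Rightarrow> bool" where
  "assignment \<MM> s \<longleftrightarrow> ran s \<subseteq> univ \<MM>"

fun satisfies :: "('a set \<Rightarrow> 'a set \<Rightarrow> 'a set \<Rightarrow> bool) \<Rightarrow> ('v \<rightharpoonup> 'a) \<Rightarrow> 'v atom \<Rightarrow> bool" where
  "satisfies ind s (xs \<bottom> ys) \<longleftrightarrow> ind (set (map (the \<circ> s) xs)) {} (set (map (the \<circ> s) ys))"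

definition entails ::
  "('f, 'r, 'a) struct \<Rightarrow> ('a set \<Rightarrow> 'a set \<Rightarrow> 'a set \<Rightarrow> bool) \<Rightarrow> 'v atom set \<Rightarrow> 'v atom \<Rightarrow> bool"
where
  "entails \<MM> ind \<Sigma> \<phi> \<longleftrightarrow>
     (\<forall>s. assignment \<MM> s \<and> \<Union> (vars ` insert \<phi> \<Sigma>) \<subseteq> dom s \<and> (\<forall>\<psi>\<in>\<Sigma>. satisfies ind s \<psi>)
        \<longrightarrow> satisfies ind s \<phi>)"

inductive derivable :: "'v atom set \<Rightarrow> 'v atom \<Rightarrow> bool" for \<Sigma> :: "'v atom set" where
  hyp: "\<phi> \<in> \<Sigma> \<Longrightarrow> derivable \<Sigma> \<phi>"
| a3: "derivable \<Sigma> (xs \<bottom> [])"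
| b3: "derivable \<Sigma> (xs \<bottom> ys) \<Longrightarrow> derivable \<Sigma> (ys \<bottom> xs)"
| c3: "derivable \<Sigma> (xs \<bottom> (ys @ zs)) \<Longrightarrow> derivable \<Sigma> (xs \<bottom> ys)"
| d3: "derivable \<Sigma> (xs \<bottom> ys) \<Longrightarrow> derivable \<Sigma> ((xs @ ys) \<bottom> zs) \<Longrightarrow>
       derivable \<Sigma> (xs \<bottom> (ys @ zs))"
| e3: "derivable \<Sigma> ([x] \<bottom> [x]) \<Longrightarrow> derivable \<Sigma> ([x] \<bottom> ys)"
| f3: "derivable \<Sigma> (xs \<bottom> ys) \<Longrightarrow> mset xs' = mset xs \<Longrightarrow> mset ys' = mset ys \<Longrightarrow>
       derivable \<Sigma> (xs' \<bottom> ys')"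
| g3: "derivable \<Sigma> ((xs @ [y] @ zs) \<bottom> ws) \<Longrightarrow> derivable \<Sigma> ((xs @ [y, y] @ zs) \<bottom> ws)"

end

theory Submission
  imports Defs
begin

text \<open>Soundness is proved by induction on derivations for assignments with values in the
  monster model; since tuples are finite and \<open>\<kappa>\<close> is uncountable, every set involved is
  bounded. The one substantial rule is \<open>d3\<close>: base monotonicity moves \<open>y\<close> into the base of
  \<open>xy \<bottom> z\<close>, and transitivity recombines the result with \<open>x \<bottom> y\<close>.
  A derivation may pass through variables on which the given assignment is undefined, so the
  induction is carried out for a total extension of it.\<close>

text \<open>The cardinal \<open>\<kappa>\<close> lies strictly above a Loewenheim-Skolem bound
  \<open>\<mu>\<close>, and \<open>\<mu>\<close> is itself infinite.\<close>

lemma monster_finite_bounded: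
  assumes "monster L K le \<kappa> \<MM>" and "finite A" and "A \<subseteq> univ \<MM>"
  shows "bounded_subset \<kappa> \<MM> A"
proof -
  obtain \<mu> where "LS_bound L K le \<mu>" and "\<mu> <o \<kappa>"
    using assms(1) by (auto simp only: monster_def)
  then have "natLeq \<le>o \<mu>" and "\<mu> <o \<kappa>"
    by (simp_all only: LS_bound_def)
  moreover have "|A| <o natLeq"
    using assms(2) by (simp only: finite_iff_ordLess_natLeq)
  ultimately have "|A| <o \<kappa>"
    using ordLess_ordLeq_trans ordLess_transitive by blast
  then show ?thesis
    using assms(3) by (simp add: bounded_subset_def)
qed

text \<open>The semantic content of rule \<open>d3\<close> over the empty base. Boundedness of the
  two unions is assumed because the locale does not say that \<open>\<kappa>\<close> is
  infinite.\<close>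

lemma (in pre_independence) independent_exchange:
  assumes bX: "bounded_subset \<kappa> \<MM> X" and bY: "bounded_subset \<kappa> \<MM> Y"
    and bZ: "bounded_subset \<kappa> \<MM> Z" and bXY: "bounded_subset \<kappa> \<MM> (X \<union> Y)"
    and bYZ: "bounded_subset \<kappa> \<MM> (Y \<union> Z)" and b0: "bounded_subset \<kappa> \<MM> {}"
    and XY: "ind X {} Y" and XYZ: "ind (X \<union> Y) {} Z"
  shows "ind X {} (Y \<union> Z)"
proof -
  have "ind Z {} (X \<union> Y)"
    using symmetry[OF bXY bZ b0 XYZ] .
  \<comment> \<open>Only a subset of the right-hand side can enter the base; this is why the atom
    was first turned around.\<close>
  then have "ind Z Y (X \<union> Y)"
    using base_monotonicity[OF bZ bXY, of "{}" Y] by blast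
  then have "ind Z Y X"
    using monotonicity[OF bZ bXY bY, of Z X] by blast
  \<comment> \<open>Transitivity wants the middle base \<open>Y\<close> contained in the left-hand
    side; normality puts it there.\<close>
  then have "ind (Z \<union> Y) Y X"
    using normality[OF bZ bX bY] by blast
  then have "ind (Y \<union> Z) Y X"
    by (simp add: Un_commute)
  moreover have "ind Y {} X"
    using symmetry[OF bX bY b0 XY] .
  ultimately have "ind (Y \<union> Z) {} X"
    using transitivity[OF bX bYZ, of "{}" Y] by blast
  then show ?thesis
    using symmetry[OF bYZ bX b0] by blast
qed

lemma satisfies_cong:
  assumes "\<And>v. v \<in> vars \<phi> \<Longrightarrow> s v = t v"
  shows "satisfies ind s \<phi> \<longleftrightarrow> satisfies ind t \<phi>"
proof (cases \<phi>)
  case (Indep us vs)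
  have "(the \<circ> s) ` set us = (the \<circ> t) ` set us" "(the \<circ> s) ` set vs = (the \<circ> t) ` set vs"
    using assms by (simp_all add: Indep cong: image_cong)
  then show ?thesis
    by (simp add: Indep)
qed

text \<open>The condition on \<open>s\<close> concerns all variables, since \<open>c3\<close> may
  erase variables that occur earlier in a derivation.\<close>

lemma derivable_satisfies:
  assumes "pre_independence L \<kappa> \<MM> ind"
    and fin: "\<And>A. finite A \<Longrightarrow> A \<subseteq> univ \<MM> \<Longrightarrow> bounded_subset \<kappa> \<MM> A"
    and val: "\<And>v. the (s v) \<in> univ \<MM>"
    and hyps: "\<And>\<psi>. \<psi> \<in> \<Sigma> \<Longrightarrow> satisfies ind s \<psi>"
    and "derivable \<Sigma> \<phi>"
  shows "satisfies ind s \<phi>"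
proof -
  interpret pre_independence L \<kappa> \<MM> ind by fact
  let ?S = "\<lambda>us. (the \<circ> s) ` set us"
  have bnd: "bounded_subset \<kappa> \<MM> (?S us)" for us
    using val by (intro fin) auto
  have b0: "bounded_subset \<kappa> \<MM> {}"
    by (intro fin) auto
  from \<open>derivable \<Sigma> \<phi>\<close> show ?thesis
  proof induction
    case (hyp \<phi>)
    then show ?case by (rule hyps)
  next
    case (a3 xs)
    then show ?case using existence[OF bnd b0, of xs] by simp
  next
    case (b3 xs ys)
    then show ?case using symmetry[OF bnd bnd b0, of xs ys] by simp
  next
    case (c3 xs ys zs)
    then show ?case
      using monotonicity[OF bnd bnd b0, of xs "ys @ zs" "?S xs" "?S ys"]
      by (simp add: image_Un)
  next
    case (d3 xs ys zs)
    then show ?case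
      \<comment> \<open>The two unions are the value sets of \<open>xs @ ys\<close> and
        \<open>ys @ zs\<close>, hence bounded.\<close>
      using independent_exchange[OF bnd bnd bnd _ _ b0, of xs ys zs]
        bnd[of "xs @ ys"] bnd[of "ys @ zs"]
      by (simp add: image_Un)
  next
    case (e3 x ys)
    then show ?case using anti_reflexivity[OF bnd bnd b0, of "[x]" ys] by simp
  next
    \<comment> \<open>Satisfaction sees only the sets of values, so permuting entries here and
      repeating one in \<open>g3\<close> change nothing.\<close>
    case (f3 xs ys xs' ys')
    then have "set xs' = set xs" "set ys' = set ys"
      by (metis set_mset_mset)+
    with f3 show ?case by simp
  next
    case (g3 xs y zs ws)
    then show ?case by simp
  qed
qed

theorem theorem4p4:
  fixes L :: "('f, 'r) vocabulary"
    and K :: "('f, 'r, 'a) struct set"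
    and le :: "('f, 'r, 'a) struct \<Rightarrow> ('f, 'r, 'a) struct \<Rightarrow> bool"
    and \<kappa> :: "'a rel"
    and \<MM> :: "('f, 'r, 'a) struct"
    and ind :: "'a set \<Rightarrow> 'a set \<Rightarrow> 'a set \<Rightarrow> bool"
    and \<Sigma> :: "'v atom set"
    and xs ys :: "'v list"
  assumes "aec L K le"
    and "amalgamation L K le"
    and "joint_embedding L K le"
    and "arbitrarily_large_models K"
    and "monster L K le \<kappa> \<MM>"
    and "pre_independence L \<kappa> \<MM> ind"
    and "derivable \<Sigma> (xs \<bottom> ys)"
  shows "entails \<MM> ind \<Sigma> (xs \<bottom> ys)"
proof -
  \<comment> \<open>Structures have nonempty universes; \<open>m\<close> will be the value of
    variables outside \<open>dom s\<close>.\<close>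
  have "\<MM> \<in> K"
    using \<open>monster L K le \<kappa> \<MM>\<close> by (simp add: monster_def)
  then have "univ \<MM> \<noteq> {}"
    using aec.K_struct[OF \<open>aec L K le\<close>] by (simp add: is_struct_def)
  then obtain m where m: "m \<in> univ \<MM>" by blast
  show ?thesis
    unfolding entails_def
  proof (intro allI impI, elim conjE)
    fix s :: "'v \<rightharpoonup> 'a"
    assume s: "assignment \<MM> s" and dom: "\<Union> (vars ` insert (xs \<bottom> ys) \<Sigma>) \<subseteq> dom s"
      and sat: "\<forall>\<psi>\<in>\<Sigma>. satisfies ind s \<psi>"
    \<comment> \<open>The right operand of \<open>++\<close> takes precedence, so \<open>t\<close>
      agrees with \<open>s\<close> on \<open>dom s\<close>.\<close>
    define t where "t = (\<lambda>v. Some m) ++ s"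
    have agree: "satisfies ind t \<psi> \<longleftrightarrow> satisfies ind s \<psi>" if "\<psi> \<in> insert (xs \<bottom> ys) \<Sigma>" for \<psi>
    proof (rule satisfies_cong)
      fix v assume "v \<in> vars \<psi>"
      with that dom have "v \<in> dom s" by blast
      then show "t v = s v" by (simp add: t_def map_add_dom_app_simps)
    qed
    have val: "the (t v) \<in> univ \<MM>" for v
      using s m by (auto simp: t_def assignment_def map_add_def ran_def split: option.split)
    have hyps: "satisfies ind t \<psi>" if "\<psi> \<in> \<Sigma>" for \<psi>
      using agree sat that by blast
    have "satisfies ind t (xs \<bottom> ys)"
      by (rule derivable_satisfies[OF \<open>pre_independence L \<kappa> \<MM> ind\<close>
            monster_finite_bounded[OF \<open>monster L K le \<kappa> \<MM>\<close>] val hyps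
            \<open>derivable \<Sigma> (xs \<bottom> ys)\<close>])
    then show "satisfies ind s (xs \<bottom> ys)"
      using agree by blast
  qed
qed

end
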